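(* Let $K\subset\mathbb{R}^n$ be a non-empty closed set with medial axis $M_K\neq\varnothing$, let $\lambda>0$ and let $x\in\mathbb{R}^n\setminus\overline{M_K}$. If $$\lambda\ \geq\ \frac{\mathrm{dist}(x;K)}{\mathrm{dist}(x;M_K)},$$ then $$\mathrm{dist}^2(x;K)=C^l_\lambda(\mathrm{dist}^2(\cdot;K))(x),$$ and consequently $M_\lambda(x;K)=0$.
   Context: $|\cdot|$ is the Euclidean norm on $\mathbb{R}^n$ and $\mathrm{dist}(x;E)=\inf\{|x-y|: y\in E\}$ for non-empty $E\subset\mathbb{R}^n$. For a non-empty closed set $K\subset\mathbb{R}^n$, the medial axis $M_K$ is the set of points $x\in\mathbb{R}^n\setminus K$ for which there are at least two different points $y_1,y_2\in K$ with $\mathrm{dist}(x;K)=|x-y_1|=|x-y_2|$. For a continuous function $f:\mathbb{R}^n\to\mathbb{R}$ bounded below, $\mathrm{co}[f]$ denotes the convex envelope, i.e. the largest convex function not greater than $f$. For $\lambda>0$ the (quadratic) lower compensated convex transform is $C^l_\lambda(f)(x)=\mathrm{co}[f+\lambda|\cdot|^2](x)-\lambda|x|^2$. The quadratic multiscale medial axis map of $K$ with scale $\lambda>0$ is $M_\lambda(x;K)=(1+\lambda)\big(\mathrm{dist}^2(x;K)-C^l_\lambda(\mathrm{dist}^2(\cdot;K))(x)\big)$, $x\in\mathbb{R}^n$. *)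

theory Defs
  imports "HOL-Analysis.Analysis"
begin

definition medial_axis :: "'a::euclidean_space set \<Rightarrow> 'a set" where
  "medial_axis K =
     {x. x \<notin> K \<and> (\<exists>y1\<in>K. \<exists>y2\<in>K. y1 \<noteq> y2 \<and>
           infdist x K = norm (x - y1) \<and> infdist x K = norm (x - y2))}"

text \<open>The greatest element is taken with respect to the pointwise order on functions. It exists
  as soon as \<open>f\<close> has a convex minorant, in particular if \<open>f\<close> is bounded below; see the lemmas that
  follow. If there is no convex minorant, the value is unspecified.\<close>

definition convex_envelope :: "('a::euclidean_space \<Rightarrow> real) \<Rightarrow> 'a \<Rightarrow> real" where
  "convex_envelope f = (GREATEST g. convex_on UNIV g \<and> g \<le> f)"

lemma convex_envelope_greatest:
  fixes f :: "'a::euclidean_space \<Rightarrow> real"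
  assumes "convex_on UNIV g0" and "g0 \<le> f"
  shows "convex_on UNIV (convex_envelope f)"
    and "convex_envelope f \<le> f"
    and "\<And>g. convex_on UNIV g \<Longrightarrow> g \<le> f \<Longrightarrow> g \<le> convex_envelope f"
proof -
  define G where "G = {g. convex_on UNIV g \<and> g \<le> f}"
  define s where "s = (\<lambda>x. SUP g\<in>G. g x)"
  have ne: "G \<noteq> {}" using assms by (auto simp: G_def)
  have bdd: "bdd_above ((\<lambda>g. g x) ` G)" for x
    by (rule bdd_aboveI[of _ "f x"]) (auto simp: G_def le_fun_def)
  have ub: "g \<le> s" if "g \<in> G" for g
    unfolding s_def le_fun_def using that bdd by (auto intro: cSUP_upper)
  have le: "s \<le> f"
    unfolding s_def le_fun_def by (intro allI cSUP_least ne) (auto simp: G_def le_fun_def)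
  have conv: "convex_on UNIV s"
  proof (rule convex_onI)
    fix t :: real and x y :: 'a
    assume t: "0 < t" "t < 1"
    show "s ((1 - t) *\<^sub>R x + t *\<^sub>R y) \<le> (1 - t) * s x + t * s y"
      unfolding s_def[THEN fun_cong, of "(1 - t) *\<^sub>R x + t *\<^sub>R y"]
    proof (rule cSUP_least[OF ne])
      fix g assume g: "g \<in> G"
      then have "g ((1 - t) *\<^sub>R x + t *\<^sub>R y) \<le> (1 - t) * g x + t * g y"
        using t by (intro convex_onD[of UNIV]) (auto simp: G_def)
      also have "\<dots> \<le> (1 - t) * s x + t * s y"
        using ub[OF g] t by (intro add_mono mult_left_mono) (auto simp: le_fun_def)
      finally show "g ((1 - t) *\<^sub>R x + t *\<^sub>R y) \<le> (1 - t) * s x + t * s y" .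
    qed
  qed simp
  have "convex_envelope f = s"
    unfolding convex_envelope_def
    by (rule Greatest_equality) (use conv le ub in \<open>auto simp: G_def\<close>)
  then show "convex_on UNIV (convex_envelope f)" "convex_envelope f \<le> f"
    "\<And>g. convex_on UNIV g \<Longrightarrow> g \<le> f \<Longrightarrow> g \<le> convex_envelope f"
    using conv le ub by (auto simp: G_def)
qed

lemma bounded_below_has_convex_minorant:
  fixes f :: "'a::euclidean_space \<Rightarrow> real"
  assumes "bdd_below (range f)"
  shows "\<exists>g. convex_on UNIV g \<and> g \<le> f"
proof -
  obtain c where "\<And>x. c \<le> f x" using assms by (auto simp: bdd_below_def)
  then have "convex_on UNIV (\<lambda>_::'a. c) \<and> (\<lambda>_. c) \<le> f"
    by (auto simp: le_fun_def convex_on_const)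
  then show ?thesis by blast
qed

definition lower_transform :: "real \<Rightarrow> ('a::euclidean_space \<Rightarrow> real) \<Rightarrow> 'a \<Rightarrow> real" where
  "lower_transform lam f x =
     convex_envelope (\<lambda>y. f y + lam * (norm y)\<^sup>2) x - lam * (norm x)\<^sup>2"

definition medial_axis_map :: "real \<Rightarrow> 'a::euclidean_space \<Rightarrow> 'a set \<Rightarrow> real" where
  "medial_axis_map lam x K =
     (1 + lam) * ((infdist x K)\<^sup>2 - lower_transform lam (\<lambda>y. (infdist y K)\<^sup>2) x)"

end

theory Submission
  imports Defs
begin

text \<open>
  Let \<open>p\<close> be a nearest point of \<open>x\<close> in \<open>K\<close>, \<open>r = |x - p| > 0\<close>, \<open>u = (x - p)/r\<close>. If the ball of
  radius \<open>\<delta>\<close> around \<open>x\<close> misses the medial axis, the nearest point map \<open>P\<close> is continuous there, so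
  by Brouwer \<open>z \<mapsto> x + \<delta> (x - P z)/|x - P z|\<close> has a fixed point \<open>z\<close>. Then \<open>x\<close> lies on the segment
  from \<open>P z\<close> to \<open>z\<close>, which forces \<open>P z = p\<close>: moving from \<open>x\<close> in the direction \<open>u\<close> increases the
  distance to \<open>K\<close> at unit speed as long as one stays within \<open>dist(x; M\<^sub>K)\<close>. The assumption
  on \<open>\<lambda>\<close> says that this applies to \<open>c = x + (x - p)/\<lambda>\<close>, so \<open>dist(c; K) = (1 + 1/\<lambda>) r\<close>.
  By Cauchy-Schwarz this gives \<open>dist\<^sup>2(y; K) + \<lambda> |y - c|\<^sup>2 \<ge> (1 + 1/\<lambda>) r\<^sup>2\<close> for all \<open>y\<close>, which, after
  expanding the square, is an affine minorant of \<open>dist\<^sup>2(\<cdot>; K) + \<lambda>|\<cdot>|\<^sup>2\<close> touching it at \<open>x\<close>.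
\<close>

text \<open>The affine function is itself a convex minorant, so it lies below the envelope, and it
  takes the value \<open>f x\<close> at \<open>x\<close>.\<close>

lemma convex_envelope_eq_if_affine_minorant:
  fixes f :: "'a::euclidean_space \<Rightarrow> real"
  assumes "\<And>y. f x + v \<bullet> (y - x) \<le> f y"
  shows "convex_envelope f x = f x"
proof -
  let ?g = "\<lambda>y. f x + v \<bullet> (y - x)"
  have conv: "convex_on UNIV ?g"
  proof (rule convex_onI)
    fix t :: real and a b :: 'a
    show "?g ((1 - t) *\<^sub>R a + t *\<^sub>R b) \<le> (1 - t) * ?g a + t * ?g b"
      by (simp add: algebra_simps inner_simps)
  qed simp
  have le: "?g \<le> f" using assms by (simp add: le_fun_def)
  show ?thesis
    using convex_envelope_greatest(2)[OF conv le] convex_envelope_greatest(3)[OF conv le conv le]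
    by (auto simp: le_fun_def intro!: antisym dest: spec[of _ x])
qed

lemma dist_closest_point:
  fixes K :: "'a::euclidean_space set"
  assumes "closed K" "K \<noteq> {}"
  shows "dist z (closest_point K z) = infdist z K"
  using closest_point_exists[OF assms, of z] assms(2)
  by (auto simp: infdist_eq_setdist setdist_closest_point[OF assms])

lemma closest_point_unique_off_medial_axis:
  fixes K :: "'a::euclidean_space set"
  assumes K: "closed K" "K \<noteq> {}"
    and z: "z \<notin> medial_axis K" and q: "q \<in> K" "dist z q = infdist z K"
  shows "q = closest_point K z"
proof (cases "z \<in> K")
  case True
  then show ?thesis using q by (simp add: closest_point_self)
next
  case False
  then show ?thesis
    using z q dist_closest_point[OF K, of z] closest_point_in_set[OF K, of z]
    unfolding medial_axis_def mem_Collect_eq dist_norm by metis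
qed

text \<open>Closed graph argument: the values stay in a compact ball, and by uniqueness of nearest
  points the graph is cut out by the closed condition \<open>dist z q = infdist z K\<close>.\<close>

lemma continuous_on_closest_point_off_medial_axis:
  fixes K :: "'a::euclidean_space set"
  assumes K: "closed K" "K \<noteq> {}" and S: "compact S" "S \<inter> medial_axis K = {}"
  shows "continuous_on S (closest_point K)"
proof -
  have "bounded ((\<lambda>z. infdist z K) ` S)"
    by (intro compact_imp_bounded compact_continuous_image continuous_intros S)
  then obtain B where B: "\<And>z. z \<in> S \<Longrightarrow> infdist z K \<le> B"
    by (auto simp: bounded_iff dest: abs_le_D1)
  obtain C where C: "\<And>z. z \<in> S \<Longrightarrow> norm z \<le> C"
    using compact_imp_bounded[OF S(1)] by (auto simp: bounded_iff)
  have range: "closest_point K \<in> S \<rightarrow> cball 0 (B + C)"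
  proof
    fix z assume z: "z \<in> S"
    have "norm (closest_point K z) \<le> dist z (closest_point K z) + norm z"
      using norm_triangle_ineq2[of "closest_point K z" z] by (simp add: dist_norm norm_minus_commute)
    also have "\<dots> \<le> B + C" using B[OF z] C[OF z] dist_closest_point[OF K] by simp
    finally show "closest_point K z \<in> cball 0 (B + C)" by simp
  qed
  have graph: "(\<lambda>z. Pair z (closest_point K z)) ` S
      = (S \<times> K) \<inter> {w. dist (fst w) (snd w) = infdist (fst w) K}" (is "_ = ?G")
    using S(2) closest_point_unique_off_medial_axis[OF K]
    by (fastforce simp: dist_closest_point[OF K] closest_point_in_set[OF K])
  have "closed ?G"
    by (intro closed_Int closed_Times closed_Collect_eq compact_imp_closed S K continuous_intros)
  then show ?thesis
    unfolding graph[symmetric]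
    by (intro continuous_from_closed_graph[OF _ range]) auto
qed

lemma infdist_extend_within_medial_free_ball:
  fixes K :: "'a::euclidean_space set"
  assumes K: "closed K" and p: "p \<in> K" "norm (x - p) = infdist x K" and x: "x \<notin> K"
    and d: "0 < d" "cball x d \<inter> medial_axis K = {}"
  shows "infdist (x + d *\<^sub>R sgn (x - p)) K = infdist x K + d"
proof -
  have ne: "K \<noteq> {}" using p by auto
  let ?P = "closest_point K"
  let ?g = "\<lambda>z. x + d *\<^sub>R sgn (x - ?P z)"
  \<comment> \<open>\<open>sgn\<close> is continuous only away from 0.\<close>
  have away: "x - ?P z \<noteq> 0" for z
    using closest_point_in_set[OF K ne, of z] x by auto
  have "continuous_on (cball x d) ?g"
    using continuous_on_closest_point_off_medial_axis[OF K ne compact_cball d(2)] away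
    by (intro continuous_intros) auto
  moreover have "?g \<in> cball x d \<rightarrow> cball x d"
    using d(1) by (auto simp: dist_norm norm_sgn)
  ultimately obtain z where z: "?g z = z"
    using brouwer_ball[OF d(1), of x ?g] by blast
  let ?n = "norm (x - ?P z)"
  \<comment> \<open>The fixed point puts \<open>x\<close> on the segment from \<open>?P z\<close> to
    \<open>z\<close>, so the distances add up.\<close>
  have "z - ?P z = (x - ?P z) + d *\<^sub>R sgn (x - ?P z)"
    using z by (metis add_diff_eq add.commute diff_add_eq)
  also have "\<dots> = (1 + d / ?n) *\<^sub>R (x - ?P z)"
    by (simp add: sgn_div_norm scaleR_left_distrib divide_inverse)
  finally have "infdist z K = \<bar>1 + d / ?n\<bar> * ?n"
    using dist_closest_point[OF K ne, of z] by (simp add: dist_norm)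
  also have "\<dots> = ?n + d"
    using away[of z] d(1) by (simp add: field_simps abs_of_pos add_pos_nonneg)
  finally have dz: "infdist z K = ?n + d" .
  \<comment> \<open>Since \<open>infdist\<close> is 1-Lipschitz, \<open>?n\<close> cannot exceed
    \<open>infdist x K\<close>. Hence \<open>?P z\<close> is a nearest point of \<open>x\<close>
    too, and uniqueness gives \<open>p\<close>.\<close>
  have "infdist z K \<le> infdist x K + dist z x"
    by (rule infdist_triangle)
  moreover have "dist z x = d"
    by (subst z[symmetric]) (use d(1) away[of z] in \<open>simp add: dist_norm norm_sgn\<close>)
  moreover have "infdist x K \<le> ?n"
    using infdist_le[OF closest_point_in_set[OF K ne, of z], of x] by (simp add: dist_norm)
  ultimately have n: "?n = infdist x K" using dz by simp
  have xM: "x \<notin> medial_axis K" using d centre_in_cball[of x d] by (metis disjoint_iff less_imp_le)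
  have "?P z = p"
    using closest_point_unique_off_medial_axis[OF K ne xM closest_point_in_set[OF K ne, of z]]
      closest_point_unique_off_medial_axis[OF K ne xM p(1)] n p(2)
    by (simp add: dist_norm)
  then show ?thesis using z n dz by simp
qed

text \<open>The closed ball of radius \<open>d\<close> may touch the medial axis, so the Brouwer
  argument is applied to radii \<open>s < d\<close> and the limit is taken.\<close>

lemma infdist_extend_up_to_medial_axis:
  fixes K :: "'a::euclidean_space set"
  assumes K: "closed K" and p: "p \<in> K" "norm (x - p) = infdist x K" and x: "x \<notin> K"
    and d: "0 < d" "d \<le> infdist x (medial_axis K)"
  shows "infdist x K + d \<le> infdist (x + d *\<^sub>R sgn (x - p)) K"
proof (rule field_le_epsilon)
  fix e :: real assume e: "0 < e"
  \<comment> \<open>The gap \<open>d - s\<close> is paid twice below, hence \<open>e / 2\<close>;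
    the bound \<open>d / 2\<close> keeps \<open>s\<close> positive.\<close>
  define s where "s = max (d / 2) (d - e / 2)"
  have s: "0 < s" "s < d" "d - s \<le> e / 2" using d(1) e by (simp_all add: s_def max_def)
  let ?u = "sgn (x - p)"
  have "cball x s \<inter> medial_axis K = {}"
  proof -
    have False if "y \<in> cball x s" "y \<in> medial_axis K" for y
      using that infdist_le[OF that(2), of x] s d by auto
    then show ?thesis by blast
  qed
  from infdist_extend_within_medial_free_ball[OF K p x s(1) this]
  have "infdist x K + s = infdist (x + s *\<^sub>R ?u) K" by simp
  also have "\<dots> \<le> infdist (x + d *\<^sub>R ?u) K + dist (x + s *\<^sub>R ?u) (x + d *\<^sub>R ?u)"
    by (rule infdist_triangle)
  also have "dist (x + s *\<^sub>R ?u) (x + d *\<^sub>R ?u) = norm ((s - d) *\<^sub>R ?u)"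
    by (simp add: dist_norm scaleR_left_diff_distrib)
  also have "\<dots> \<le> d - s" using s by (simp add: norm_sgn)
  finally show "infdist x K + d \<le> infdist (x + d *\<^sub>R ?u) K + e" using s by linarith
qed

lemma infdist_square_lower_bound:
  fixes K :: "'a::euclidean_space set"
  assumes lam: "0 < lam" and p: "norm (x - p) = infdist x K"
    and c: "(1 + 1 / lam) * infdist x K \<le> infdist (x + (1 / lam) *\<^sub>R (x - p)) K"
  shows "(infdist x K)\<^sup>2 + 2 * ((x - p) \<bullet> (y - x)) \<le> (infdist y K)\<^sup>2 + lam * (norm (y - x))\<^sup>2"
proof -
  define r where "r = infdist x K"
  define a where "a = infdist y K"
  define b where "b = norm (y - (x + (1 / lam) *\<^sub>R (x - p)))"
  have r: "0 \<le> r" by (simp add: r_def infdist_nonneg)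
  have "(1 + 1 / lam) * r \<le> a + b"
    using c infdist_triangle[of "x + (1 / lam) *\<^sub>R (x - p)" K y]
    unfolding r_def a_def b_def dist_norm norm_minus_commute[of y] by linarith
  then have "(lam + 1) * r \<le> lam * (a + b)"
    using lam by (simp add: field_simps)
  then have "((lam + 1) * r)\<^sup>2 \<le> (lam * (a + b))\<^sup>2"
    using r lam by (intro power_mono) auto
  \<comment> \<open>The added square is the exact deficit in the weighted Cauchy-Schwarz
    inequality.\<close>
  also have "\<dots> \<le> (lam * (a + b))\<^sup>2 + lam * (a - lam * b)\<^sup>2"
    using lam by simp
  also have "\<dots> = (lam + 1) * (lam * (a\<^sup>2 + lam * b\<^sup>2))"
    by (simp add: power2_eq_square algebra_simps)
  finally have "(lam + 1) * ((lam + 1) * r\<^sup>2) \<le> (lam + 1) * (lam * (a\<^sup>2 + lam * b\<^sup>2))"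
    by (simp add: power2_eq_square algebra_simps)
  then have "(lam + 1) * r\<^sup>2 \<le> lam * (a\<^sup>2 + lam * b\<^sup>2)"
    using lam by simp
  then have main: "r\<^sup>2 + r\<^sup>2 / lam \<le> a\<^sup>2 + lam * b\<^sup>2"
    using lam by (simp add: field_simps)
  have "b\<^sup>2 = (norm ((y - x) - (1 / lam) *\<^sub>R (x - p)))\<^sup>2"
    by (simp add: b_def algebra_simps)
  also have "\<dots> = (norm (y - x))\<^sup>2 + (1 / lam)\<^sup>2 * r\<^sup>2 - 2 / lam * ((x - p) \<bullet> (y - x))"
    unfolding r_def p[symmetric] power2_norm_eq_inner inner_diff_left[of "y - x"]
      inner_diff_right[of _ "y - x"] inner_scaleR_left inner_scaleR_right
      inner_commute[of "y - x" "x - p"]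
    by (simp add: power2_eq_square diff_divide_distrib)
  finally have b: "b\<^sup>2 = (norm (y - x))\<^sup>2 + (1 / lam)\<^sup>2 * r\<^sup>2 - 2 / lam * ((x - p) \<bullet> (y - x))" .
  have "lam * b\<^sup>2 = lam * (norm (y - x))\<^sup>2 + r\<^sup>2 / lam - 2 * ((x - p) \<bullet> (y - x))"
    unfolding b using lam by (simp add: field_simps power2_eq_square)
  then show ?thesis using main unfolding r_def a_def by linarith
qed

lemma lower_transform_infdist_square_eq:
  fixes K :: "'a::euclidean_space set"
  assumes K: "K \<noteq> {}" "closed K" and M: "medial_axis K \<noteq> {}" and lam: "0 < lam"
    and x: "x \<notin> closure (medial_axis K)"
    and le: "infdist x K / infdist x (medial_axis K) \<le> lam"
  shows "lower_transform lam (\<lambda>y. (infdist y K)\<^sup>2) x = (infdist x K)\<^sup>2"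
proof -
  define p where "p = closest_point K x"
  have p: "p \<in> K" "norm (x - p) = infdist x K"
    using closest_point_in_set[OF K(2,1)] dist_closest_point[OF K(2,1), of x]
    by (simp_all add: p_def dist_norm)
  \<comment> \<open>Positivity excludes the convention \<open>r / 0 = 0\<close>, so the quotient
    bound can be cleared of its denominator.\<close>
  have R: "0 < infdist x (medial_axis K)"
    using x M infdist_pos_not_in_closed[of "closure (medial_axis K)" x]
      in_closure_iff_infdist_zero[OF M] infdist_nonneg[of x "medial_axis K"]
    by (simp add: less_le)
  have c: "(1 + 1 / lam) * infdist x K \<le> infdist (x + (1 / lam) *\<^sub>R (x - p)) K"
  proof (cases "x \<in> K")
    case True
    then show ?thesis by (simp add: infdist_nonneg)
  next
    case False
    then have r: "0 < infdist x K"
      using infdist_pos_not_in_closed[OF K(2,1)] by simp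
    \<comment> \<open>This is the length of \<open>(1 / lam) *\<^sub>R (x - p)\<close>, used as the
      extension length \<open>d\<close>.\<close>
    have "infdist x K / lam \<le> infdist x (medial_axis K)"
      using le lam R by (simp add: field_simps)
    from infdist_extend_up_to_medial_axis[OF K(2) p False _ this]
    show ?thesis using r lam p(2)
      by (simp add: sgn_div_norm field_simps)
  qed
  let ?f = "\<lambda>y. (infdist y K)\<^sup>2 + lam * (norm y)\<^sup>2"
  \<comment> \<open>The slope is \<open>2 *\<^sub>R (x - p)\<close> from the bound on the squared
    distance plus the gradient of \<open>lam * (norm y)\<^sup>2\<close> at \<open>x\<close>.\<close>
  have "?f x + (2 *\<^sub>R (x - p) + (2 * lam) *\<^sub>R x) \<bullet> (y - x) \<le> ?f y" for y
  proof -
    have "(norm (y - x))\<^sup>2 = (norm y)\<^sup>2 - (norm x)\<^sup>2 - 2 * (x \<bullet> (y - x))"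
      by (simp add: power2_norm_eq_inner inner_simps inner_commute)
    then have "lam * (norm (y - x))\<^sup>2
        = lam * (norm y)\<^sup>2 - lam * (norm x)\<^sup>2 - 2 * lam * (x \<bullet> (y - x))"
      by (simp only: right_diff_distrib mult.left_commute mult.assoc)
    then show ?thesis
      using infdist_square_lower_bound[OF lam p(2) c, of y]
      unfolding inner_add_left inner_scaleR_left by linarith
  qed
  from convex_envelope_eq_if_affine_minorant[of ?f, OF this]
  show ?thesis by (simp add: lower_transform_def)
qed

theorem theorem3p3:
  fixes K :: "(real ^ 'n) set" and lam :: real and x :: "real ^ 'n"
  assumes "K \<noteq> {}" and "closed K"
    and "medial_axis K \<noteq> {}"
    and "lam > 0"
    and "x \<notin> closure (medial_axis K)"
    and "lam \<ge> infdist x K / infdist x (medial_axis K)"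
  shows "(infdist x K)\<^sup>2 = lower_transform lam (\<lambda>y. (infdist y K)\<^sup>2) x
       \<and> medial_axis_map lam x K = 0"
  using lower_transform_infdist_square_eq[OF assms] by (simp add: medial_axis_map_def)

end
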